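(* There exists a basic sequence $Q=(q_n)_{n\in\mathbb N}$, each of whose terms $q_n$ is a power of $2$ (with $q_n\ge 2$), such that $Q$ is $\Delta^0_2$ (i.e., the function $n\mapsto q_n$ is computable from the halting problem $\emptyset'$), and such that no computable real number $x\in(0,1)$ is $Q$-distribution-normal.
   Context: A basic sequence is a sequence $Q=(q_n)_{n\in\mathbb N}$ of integers with $q_n\ge 2$ for all $n$. Given a basic sequence $Q$, a real $x\in(0,1)$ is called $Q$-distribution-normal if the sequence $x,\ q_0x,\ q_0q_1x,\ q_0q_1q_2x,\ \ldots$ is uniformly distributed modulo $1$, i.e., for every interval $I\subseteq[0,1]$ of length $\varepsilon$, the proportion of indices $k<n$ for which the $k$-th term of this sequence, taken mod $1$, lies in $I$ tends to $\varepsilon$ as $n\to\infty$. A real $x\in[0,1]$ is computable if $x=\sum_{n}\alpha(n)2^{-n-1}$ for some $\alpha\in 2^{\mathbb N}$ with $\{n:\alpha(n)=1\}$ a computable set. *)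

theory Defs
  imports Complex_Main "HOL-Library.Nat_Bijection"
begin

text \<open>
  Kleene's \<open>\<mu>\<close>-recursive functions relative to a set \<open>A\<close>, given by programs acting on argument lists.
  Programs carry no arity; a program applied to an argument list that is too short diverges.
\<close>

datatype prog =
    Zero
  | Succ
  | Proj nat
  | Query
  | Comp prog "prog list"
  | PrimRec prog prog
  | Mu prog

text \<open>\<open>halts_with A p xs y\<close>: with access to the characteristic function of \<open>A\<close>
  (through \<open>Query\<close>), the program \<open>p\<close> halts on the arguments \<open>xs\<close> with value \<open>y\<close>.\<close>

inductive halts_with :: "nat set \<Rightarrow> prog \<Rightarrow> nat list \<Rightarrow> nat \<Rightarrow> bool" for A :: "nat set" where
  zero: "halts_with A Zero xs 0"
| succ: "halts_with A Succ (x # xs) (Suc x)"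
| proj: "i < length xs \<Longrightarrow> halts_with A (Proj i) xs (xs ! i)"
| query: "halts_with A Query (x # xs) (if x \<in> A then 1 else 0)"
| comp: "list_all2 (\<lambda>g y. halts_with A g xs y) gs ys \<Longrightarrow> halts_with A f ys z
    \<Longrightarrow> halts_with A (Comp f gs) xs z"
| primrec_0: "halts_with A f xs y \<Longrightarrow> halts_with A (PrimRec f g) (0 # xs) y"
| primrec_Suc: "halts_with A (PrimRec f g) (n # xs) y \<Longrightarrow> halts_with A g (n # y # xs) z
    \<Longrightarrow> halts_with A (PrimRec f g) (Suc n # xs) z"
| mu: "halts_with A f (n # xs) 0 \<Longrightarrow> \<forall>i<n. \<exists>y>0. halts_with A f (i # xs) y
    \<Longrightarrow> halts_with A (Mu f) xs n"

inductive_cases halts_with_ZeroE: "halts_with A Zero xs y"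
inductive_cases halts_with_SuccE: "halts_with A Succ xs y"
inductive_cases halts_with_ProjE: "halts_with A (Proj i) xs y"
inductive_cases halts_with_QueryE: "halts_with A Query xs y"
inductive_cases halts_with_CompE: "halts_with A (Comp f gs) xs y"
inductive_cases halts_with_PrimRec_0E: "halts_with A (PrimRec f g) (0 # xs) y"
inductive_cases halts_with_PrimRec_SucE: "halts_with A (PrimRec f g) (Suc n # xs) y"
inductive_cases halts_with_MuE: "halts_with A (Mu f) xs y"

lemma halts_with_deterministic:
  "halts_with A p xs y \<Longrightarrow> halts_with A p xs z \<Longrightarrow> y = z"
proof (induction arbitrary: z rule: halts_with.induct)
  case (zero xs)
  then show ?case by (rule halts_with_ZeroE) simp
next
  case (succ x xs)
  then show ?case by (rule halts_with_SuccE) simp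
next
  case (proj i xs)
  from proj.prems show ?case by (rule halts_with_ProjE) simp
next
  case (query x xs)
  then show ?case by (rule halts_with_QueryE) simp_all
next
  case (comp xs gs ys f w)
  from comp.prems obtain ys' where
    ys': "list_all2 (\<lambda>g y. halts_with A g xs y) gs ys'" "halts_with A f ys' z"
    by (rule halts_with_CompE)
  have "ys = ys'"
    using comp.IH(1) ys'(1) by (simp add: list_all2_conv_all_nth list_eq_iff_nth_eq)
  then show ?case using comp.IH(2) ys'(2) by blast
next
  case (primrec_0 f xs y g)
  from primrec_0.prems show ?case
    by (rule halts_with_PrimRec_0E) (rule primrec_0.IH)
next
  case (primrec_Suc f g n xs y w)
  from primrec_Suc.prems obtain y' where
    y': "halts_with A (PrimRec f g) (n # xs) y'" "halts_with A g (n # y' # xs) z"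
    by (rule halts_with_PrimRec_SucE)
  from primrec_Suc.IH(1)[OF y'(1)] y'(2) show ?case
    by (intro primrec_Suc.IH(2)) simp
next
  case (mu f n xs)
  from mu.prems have z: "halts_with A f (z # xs) 0" "\<forall>i<z. \<exists>y>0. halts_with A f (i # xs) y"
    by (auto elim: halts_with_MuE)
  have "\<not> n < z" using z(2) mu.IH(1) by (metis less_irrefl)
  moreover have "\<not> z < n" using z(1) mu.IH(2) by (metis less_irrefl)
  ultimately show ?case by simp
qed

primrec godel_number :: "prog \<Rightarrow> nat" where
  "godel_number Zero = prod_encode (0, 0)"
| "godel_number Succ = prod_encode (1, 0)"
| "godel_number (Proj i) = prod_encode (2, i)"
| "godel_number Query = prod_encode (3, 0)"
| "godel_number (Comp f gs) =
    prod_encode (4, prod_encode (godel_number f, list_encode (map godel_number gs)))"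
| "godel_number (PrimRec f g) =
    prod_encode (5, prod_encode (godel_number f, godel_number g))"
| "godel_number (Mu f) = prod_encode (6, godel_number f)"

lemma godel_number_inject: "godel_number p = godel_number q \<Longrightarrow> p = q"
proof (induction p arbitrary: q)
  case (Comp f gs)
  obtain f' gs' where q: "q = Comp f' gs'" "godel_number f = godel_number f'"
      "map godel_number gs = map godel_number gs'"
    using Comp.prems by (cases q) (auto dest: list_encode_eq[THEN iffD1])
  have "gs = gs'"
    using q(3)
  proof (intro nth_equalityI)
    show "length gs = length gs'" using q(3) by (rule map_eq_imp_length_eq)
    fix i assume i: "i < length gs"
    then have "godel_number (gs ! i) = godel_number (gs' ! i)"
      using q(3) \<open>length gs = length gs'\<close> by (metis nth_map)
    then show "gs ! i = gs' ! i" using Comp.IH(2) i by simp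
  qed
  with q Comp.IH(1) show ?case by simp
qed (case_tac q; auto)+

definition computable_in :: "nat set \<Rightarrow> (nat \<Rightarrow> nat) \<Rightarrow> bool" where
  "computable_in A f \<longleftrightarrow> (\<exists>p. \<forall>n. halts_with A p [n] (f n))"

definition computable_set :: "nat set \<Rightarrow> bool" where
  "computable_set S \<longleftrightarrow> computable_in {} (\<lambda>n. if n \<in> S then 1 else 0)"

definition jump :: "nat set \<Rightarrow> nat set" where
  "jump A = {godel_number p | p. \<exists>y. halts_with A p [godel_number p] y}"

text \<open>With the empty set as oracle set, \<open>Query\<close> merely computes the constant 0, so
  \<open>halts_with {}\<close> describes unrelativized computation and \<open>jump {}\<close> is the halting problem.\<close>

definition halting_problem :: "nat set" where
  "halting_problem = jump {}"

definition Delta02 :: "(nat \<Rightarrow> nat) \<Rightarrow> bool" where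
  "Delta02 f \<longleftrightarrow> computable_in halting_problem f"

definition computable_real :: "real \<Rightarrow> bool" where
  "computable_real x \<longleftrightarrow>
    (\<exists>\<alpha> :: nat \<Rightarrow> nat. range \<alpha> \<subseteq> {0, 1} \<and> computable_set {n. \<alpha> n = 1} \<and>
      (\<lambda>n. real (\<alpha> n) / 2 ^ (n + 1)) sums x)"

definition basic_sequence :: "(nat \<Rightarrow> nat) \<Rightarrow> bool" where
  "basic_sequence q \<longleftrightarrow> (\<forall>n. q n \<ge> 2)"

text \<open>All four kinds of bounded intervals are covered, including degenerate ones.\<close>

definition uniformly_distributed_mod_1 :: "(nat \<Rightarrow> real) \<Rightarrow> bool" where
  "uniformly_distributed_mod_1 u \<longleftrightarrow>
    (\<forall>a b. \<forall>I \<in> {{a..b}, {a..<b}, {a<..b}, {a<..<b}}. 0 \<le> a \<and> a \<le> b \<and> b \<le> 1 \<longrightarrow>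
      (\<lambda>n. real (card {k. k < n \<and> frac (u k) \<in> I}) / real n) \<longlonglongrightarrow> b - a)"

definition distribution_normal :: "(nat \<Rightarrow> nat) \<Rightarrow> real \<Rightarrow> bool" where
  "distribution_normal q x \<longleftrightarrow> uniformly_distributed_mod_1 (\<lambda>k. real (\<Prod>i<k. q i) * x)"

end

theory Submission imports Defs begin

text \<open>
  If all \<open>q\<^sub>i\<close> are powers of 2, then \<open>q\<^sub>0 \<cdots> q\<^bsub>k-1\<^esub> x\<close> modulo 1 is the binary expansion of \<open>x\<close> shifted
  by some \<open>m\<^sub>k\<close>, so it suffices to choose shifts \<open>m\<^sub>k\<close> at which the digits of a computable \<open>x\<close> are
  not equidistributed. Call \<open>m\<close> bad for a program if the program yields 1 at \<open>m\<close> and 0 at \<open>m + 1\<close>.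
  The halting problem decides badness, and of two consecutive positions at most one is bad. Hence
  for \<open>8\<^sup>e \<le> k < 8\<^bsup>e+1\<^esup>\<close> we can let \<open>m\<^bsub>k+1\<^esub>\<close> be whichever of \<open>m\<^sub>k + 1\<close>, \<open>m\<^sub>k + 2\<close> is not bad for the
  program with number \<open>e\<close>. If that program computes the digits of \<open>x\<close>, then at most about one eighth
  of the first \<open>8\<^bsup>e+1\<^esup>\<close> terms lie in \<open>(1/2, 3/4)\<close>, an interval of length one quarter; and this happens
  for infinitely many \<open>e\<close>, since every program has infinitely many equivalent ones.
\<close>

subsection \<open>Closure properties of relative computability\<close>

text \<open>Functions of whole argument lists of a fixed length, so that the closure rules below act
  as introduction rules that follow the syntax of a term.\<close>

definition recursive_in :: "nat set \<Rightarrow> nat \<Rightarrow> (nat list \<Rightarrow> nat) \<Rightarrow> bool" where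
  "recursive_in A n f \<longleftrightarrow> (\<exists>p. \<forall>xs. length xs = n \<longrightarrow> halts_with A p xs (f xs))"

lemma computable_in_iff: "computable_in A h \<longleftrightarrow> recursive_in A 1 (\<lambda>xs. h (xs ! 0))"
proof
  assume "computable_in A h"
  then obtain p where "\<And>n. halts_with A p [n] (h n)"
    unfolding computable_in_def by blast
  then show "recursive_in A 1 (\<lambda>xs. h (xs ! 0))"
    unfolding recursive_in_def by (intro exI[of _ p]) (auto simp: length_Suc_conv)
next
  assume "recursive_in A 1 (\<lambda>xs. h (xs ! 0))"
  then obtain p where p: "\<And>xs. length xs = 1 \<Longrightarrow> halts_with A p xs (h (xs ! 0))"
    unfolding recursive_in_def by blast
  have "halts_with A p [n] (h n)" for n
    using p[of "[n]"] by simp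
  then show "computable_in A h"
    unfolding computable_in_def by blast
qed

lemma recursive_in_nth: "i < n \<Longrightarrow> recursive_in A n (\<lambda>xs. xs ! i)"
  unfolding recursive_in_def by (auto intro: halts_with.proj)

lemma recursive_in_compose:
  assumes f: "recursive_in A (length gs) f" and gs: "\<forall>g\<in>set gs. recursive_in A n g"
  shows "recursive_in A n (\<lambda>xs. f (map (\<lambda>g. g xs) gs))"
proof -
  obtain p where p: "\<And>ys. length ys = length gs \<Longrightarrow> halts_with A p ys (f ys)"
    using f unfolding recursive_in_def by blast
  obtain r where r: "\<forall>g\<in>set gs. \<forall>xs. length xs = n \<longrightarrow> halts_with A (r g) xs (g xs)"
    using gs unfolding recursive_in_def by metis
  have "halts_with A (Comp p (map r gs)) xs (f (map (\<lambda>g. g xs) gs))" if "length xs = n" for xs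
  proof (rule halts_with.comp)
    show "list_all2 (\<lambda>p y. halts_with A p xs y) (map r gs) (map (\<lambda>g. g xs) gs)"
      using r that by (auto simp: list.rel_map intro!: list.rel_refl_strong)
  qed (simp add: p)
  then show ?thesis
    unfolding recursive_in_def by blast
qed

lemma recursive_in_apply:
  assumes "computable_in A h" and "recursive_in A n t"
  shows "recursive_in A n (\<lambda>xs. h (t xs))"
  using recursive_in_compose[of A "[t]" "\<lambda>xs. h (xs ! 0)" n] assms
  by (simp add: computable_in_iff)

text \<open>The number of rounds is itself a term \<open>t\<close>: \<open>PrimRec\<close> is
  composed with \<open>t\<close> and with all \<open>n\<close> projections, which hand the arguments
  \<open>xs\<close> on to it.\<close>

lemma recursive_in_rec_nat:
  assumes t: "recursive_in A n t" and f: "recursive_in A n f"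
    and g: "recursive_in A (Suc (Suc n)) g"
  shows "recursive_in A n (\<lambda>xs. rec_nat (f xs) (\<lambda>i y. g (i # y # xs)) (t xs))"
proof -
  obtain pf where pf: "\<And>xs. length xs = n \<Longrightarrow> halts_with A pf xs (f xs)"
    using f unfolding recursive_in_def by blast
  obtain pg where pg: "\<And>xs. length xs = Suc (Suc n) \<Longrightarrow> halts_with A pg xs (g xs)"
    using g unfolding recursive_in_def by blast
  have "halts_with A (PrimRec pf pg) (k # xs) (rec_nat (f xs) (\<lambda>i y. g (i # y # xs)) k)"
    if "length xs = n" for k xs
    using that by (induction k) (auto intro!: pf pg intro: halts_with.intros)
  then have "recursive_in A (Suc n)
      (\<lambda>ys. rec_nat (f (tl ys)) (\<lambda>i y. g (i # y # tl ys)) (hd ys))"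
    unfolding recursive_in_def by (intro exI[of _ "PrimRec pf pg"]) (auto simp: length_Suc_conv)
  then have R: "recursive_in A n (\<lambda>xs. rec_nat (f (map (\<lambda>i. xs ! i) [0..<n]))
      (\<lambda>i y. g (i # y # map (\<lambda>i. xs ! i) [0..<n])) (t xs))"
    using recursive_in_compose[of A "t # map (\<lambda>i xs. xs ! i) [0..<n]"
        "\<lambda>ys. rec_nat (f (tl ys)) (\<lambda>i y. g (i # y # tl ys)) (hd ys)" n] t
    by (auto simp: recursive_in_nth comp_def)
  have "map (\<lambda>i. xs ! i) [0..<n] = xs" if "length xs = n" for xs :: "nat list"
    using map_nth[of xs] that by simp
  with R show ?thesis
    unfolding recursive_in_def by auto
qed

lemma recursive_in_Suc: "recursive_in A n f \<Longrightarrow> recursive_in A n (\<lambda>xs. Suc (f xs))"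
  by (rule recursive_in_apply) (auto simp: computable_in_def intro: halts_with.succ)

lemma recursive_in_const: "recursive_in A n (\<lambda>xs. c)"
proof (induction c)
  case 0
  show ?case unfolding recursive_in_def by (auto intro: halts_with.zero)
qed (rule recursive_in_Suc)

lemma recursive_in_query:
  "recursive_in A n f \<Longrightarrow> recursive_in A n (\<lambda>xs. of_bool (f xs \<in> A))"
proof (rule recursive_in_apply[where h = "\<lambda>x. of_bool (x \<in> A)"])
  have "halts_with A Query [x] (of_bool (x \<in> A))" for x
    using halts_with.query[of A x "[]"] by (simp add: of_bool_def)
  then show "computable_in A (\<lambda>x. of_bool (x \<in> A))"
    unfolding computable_in_def by blast
qed

text \<open>The step has arity 3 because it receives the original argument besides the counter and
  the previous value.\<close>

lemma computable_in_primrec: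
  assumes 0: "h 0 = c" and Suc: "\<And>i. h (Suc i) = g i (h i)"
    and g: "recursive_in A 3 (\<lambda>xs. g (xs ! 0) (xs ! 1))"
  shows "computable_in A h"
proof -
  have "h = rec_nat c g"
  proof
    show "h k = rec_nat c g k" for k by (induction k) (simp_all add: 0 Suc)
  qed
  then show ?thesis
    using recursive_in_rec_nat[of A 1 "\<lambda>xs. xs ! 0" "\<lambda>_. c" "\<lambda>xs. g (xs ! 0) (xs ! 1)"] g
    by (simp add: computable_in_iff recursive_in_nth recursive_in_const numeral_3_eq_3)
qed

lemma recursive_in_add:
  assumes f: "recursive_in A n f" and g: "recursive_in A n g"
  shows "recursive_in A n (\<lambda>xs. f xs + g xs)"
proof -
  have "rec_nat a (\<lambda>_. Suc) b = a + b" for a b :: nat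
    by (induction b) auto
  then show ?thesis
    using recursive_in_rec_nat[OF g f recursive_in_Suc[OF recursive_in_nth[of 1]]] by simp
qed

lemma recursive_in_diff:
  assumes f: "recursive_in A n f" and g: "recursive_in A n g"
  shows "recursive_in A n (\<lambda>xs. f xs - g xs)"
proof -
  have pred: "computable_in A (\<lambda>x. x - 1)"
    by (rule computable_in_primrec[where c = 0 and g = "\<lambda>i y. i"]) (auto intro: recursive_in_nth)
  have "rec_nat a (\<lambda>_ y. y - 1) b = a - b" for a b :: nat
    by (induction b) auto
  then show ?thesis
    using recursive_in_rec_nat[OF g f recursive_in_apply[OF pred recursive_in_nth[of 1]]] by simp
qed

lemma recursive_in_mult_const: "recursive_in A n f \<Longrightarrow> recursive_in A n (\<lambda>xs. c * f xs)"
  by (induction c) (auto intro: recursive_in_const recursive_in_add)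

lemma computable_in_power: "computable_in A (\<lambda>i. c ^ i)"
  by (rule computable_in_primrec[where c = 1 and g = "\<lambda>i y. c * y"])
    (auto intro!: recursive_in_nth recursive_in_mult_const)

lemma computable_in_triangle: "computable_in A triangle"
  by (rule computable_in_primrec[where c = 0 and g = "\<lambda>i y. y + Suc i"])
    (auto intro!: recursive_in_nth recursive_in_add recursive_in_Suc simp del: add_Suc_right)

lemma recursive_in_prod_encode:
  "recursive_in A n f \<Longrightarrow> recursive_in A n g \<Longrightarrow> recursive_in A n (\<lambda>xs. prod_encode (f xs, g xs))"
  unfolding prod_encode_def
  by (auto intro!: recursive_in_add recursive_in_apply[OF computable_in_triangle])

lemmas recursive_in_intros = recursive_in_nth recursive_in_Suc recursive_in_const
  recursive_in_query recursive_in_add recursive_in_diff recursive_in_mult_const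
  recursive_in_apply[OF computable_in_power] recursive_in_prod_encode

subsection \<open>Reducing badness of a position to the halting problem\<close>

text \<open>Hard-wires an input: \<open>Comp p [const_prog m]\<close> ignores its argument and runs
  \<open>p\<close> on \<open>m\<close>, which takes the place of the s-m-n theorem.\<close>

primrec const_prog :: "nat \<Rightarrow> prog" where
  "const_prog 0 = Zero"
| "const_prog (Suc m) = Comp Succ [const_prog m]"

lemma halts_with_const_prog: "halts_with A (const_prog m) xs m"
  by (induction m) (auto intro: halts_with.intros)

lemma computable_in_godel_number_const_prog: "computable_in A (\<lambda>m. godel_number (const_prog m))"
  \<comment> \<open>\<open>Suc (prod_encode (y, 0))\<close> is
    \<open>list_encode [y]\<close>.\<close>
  by (rule computable_in_primrec[where c = "godel_number Zero" and g =
      "\<lambda>i y. prod_encode (4, prod_encode (godel_number Succ, Suc (prod_encode (y, 0))))"])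
    (auto intro!: recursive_in_intros)

lemma halts_with_Comp_iff:
  "halts_with A (Comp f [g, h]) xs z \<longleftrightarrow>
    (\<exists>y1 y2. halts_with A g xs y1 \<and> halts_with A h xs y2 \<and> halts_with A f [y1, y2] z)"
  by (fastforce elim!: halts_with_CompE simp: list_all2_Cons1 intro!: halts_with.comp)

lemma halts_with_Comp_const_prog_iff:
  "halts_with A (Comp p [const_prog m]) xs y \<longleftrightarrow> halts_with A p [m] y"
  by (auto elim!: halts_with_CompE simp: list_all2_Cons1 intro!: halts_with.comp
      intro: halts_with_const_prog dest: halts_with_deterministic[OF halts_with_const_prog])

text \<open>Unbounded search over a test that ignores the search variable:
  \<open>y2 + (1 - y1)\<close>, with truncated subtraction, vanishes iff \<open>0 < y1\<close> and
  \<open>y2 = 0\<close>, so the search stops at 0 or never.\<close>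

lemma descent_test_exists:
  "\<exists>d. \<forall>y1 y2. (\<exists>z. halts_with A d [y1, y2] z) \<longleftrightarrow> 0 < y1 \<and> y2 = 0"
proof -
  have "recursive_in A 3 (\<lambda>xs. xs ! 2 + (1 - xs ! 1))"
    by (intro recursive_in_intros) auto
  then obtain p where p: "\<And>xs. length xs = 3 \<Longrightarrow> halts_with A p xs (xs ! 2 + (1 - xs ! 1))"
    unfolding recursive_in_def by blast
  have p: "halts_with A p [i, y1, y2] (y2 + (1 - y1))" for i y1 y2
    using p[of "[i, y1, y2]"] by simp
  have "(\<exists>z. halts_with A (Mu p) [y1, y2] z) \<longleftrightarrow> 0 < y1 \<and> y2 = 0" for y1 y2
  proof
    assume "\<exists>z. halts_with A (Mu p) [y1, y2] z"
    then obtain z where "halts_with A p [z, y1, y2] 0"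
      by (auto elim: halts_with_MuE)
    with p have "y2 + (1 - y1) = 0"
      by (rule halts_with_deterministic)
    then show "0 < y1 \<and> y2 = 0" by simp
  next
    assume "0 < y1 \<and> y2 = 0"
    then have "halts_with A p [0, y1, y2] 0"
      using p[of 0 y1 y2] by simp
    then show "\<exists>z. halts_with A (Mu p) [y1, y2] z"
      by (auto intro: halts_with.mu)
  qed
  then show ?thesis by blast
qed

text \<open>A number \<open>e\<close> that codes no program is never bad, since then \<open>c e m\<close> codes no program either;
  hence no decoding and no universal program is needed.\<close>

lemma descent_reduction:
  obtains c :: "nat \<Rightarrow> nat \<Rightarrow> nat" where
    "\<And>A n f g. recursive_in A n f \<Longrightarrow> recursive_in A n g \<Longrightarrow> recursive_in A n (\<lambda>xs. c (f xs) (g xs))"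
    "\<And>p m. c (godel_number p) m \<in> halting_problem \<longleftrightarrow>
      (\<exists>y>0. halts_with {} p [m] y) \<and> halts_with {} p [Suc m] 0"
proof -
  obtain d where d: "\<And>y1 y2. (\<exists>z. halts_with {} d [y1, y2] z) \<longleftrightarrow> 0 < y1 \<and> y2 = 0"
    using descent_test_exists[of "{}"] by blast
  \<comment> \<open>If \<open>e\<close> codes \<open>p\<close>, then \<open>code_at e m\<close>
    codes \<open>Comp p [const_prog m]\<close>; it is computed from \<open>e\<close> by arithmetic
    alone.\<close>
  define code_at where "code_at e m =
    prod_encode (4, prod_encode (e, Suc (prod_encode (godel_number (const_prog m), 0))))" for e m
  define c where "c e m = prod_encode (4, prod_encode (godel_number d,
    Suc (prod_encode (code_at e m, Suc (prod_encode (code_at e (Suc m), 0))))))" for e m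
  have "recursive_in A n (\<lambda>xs. c (f xs) (g xs))"
    if "recursive_in A n f" and "recursive_in A n g" for A n f g
    unfolding c_def code_at_def
    using that
    by (intro recursive_in_intros recursive_in_apply[OF computable_in_godel_number_const_prog])
  moreover have "c (godel_number p) m \<in> halting_problem \<longleftrightarrow>
      (\<exists>y>0. halts_with {} p [m] y) \<and> halts_with {} p [Suc m] 0" for p m
  proof -
    define r where "r = Comp d [Comp p [const_prog m], Comp p [const_prog (Suc m)]]"
    have c: "c (godel_number p) m = godel_number r"
      by (simp add: c_def code_at_def r_def)
    have "godel_number r \<in> halting_problem \<longleftrightarrow> (\<exists>y. halts_with {} r [godel_number r] y)"
      unfolding halting_problem_def jump_def by (auto dest: godel_number_inject)
    \<comment> \<open>The program \<open>r\<close> ignores its argument, so the self-application in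
      \<open>jump\<close> amounts to plain halting.\<close>
    also have "\<dots> \<longleftrightarrow> (\<exists>y1 y2. halts_with {} p [m] y1 \<and> halts_with {} p [Suc m] y2 \<and>
        (\<exists>z. halts_with {} d [y1, y2] z))"
      unfolding r_def halts_with_Comp_iff halts_with_Comp_const_prog_iff by blast
    also have "\<dots> \<longleftrightarrow> (\<exists>y>0. halts_with {} p [m] y) \<and> halts_with {} p [Suc m] 0"
      unfolding d by auto
    finally show ?thesis unfolding c .
  qed
  ultimately show ?thesis by (rule that)
qed

subsection \<open>Blocks and padding\<close>

text \<open>For \<open>k > 0\<close> this is the integer part of the logarithm of \<open>k\<close>
  to base 8. The truncated difference adds 1 exactly when \<open>Suc k\<close> reaches the next
  power of 8, so computability needs no case distinction.\<close>

primrec block :: "nat \<Rightarrow> nat" where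
  "block 0 = 0"
| "block (Suc k) = block k + (1 - (8 ^ Suc (block k) - Suc k))"

lemma computable_in_block: "computable_in A block"
  by (rule computable_in_primrec[where c = 0 and g = "\<lambda>k y. y + (1 - (8 ^ Suc y - Suc k))"])
    (auto intro!: recursive_in_intros simp del: power_Suc)

lemma block_bounds: "k < 8 ^ Suc (block k) \<and> (block k = 0 \<or> 8 ^ block k \<le> k)"
proof (induction k)
  case (Suc k)
  show ?case
  proof (cases "Suc k < 8 ^ Suc (block k)")
    case True
    then have "block (Suc k) = block k" by simp
    with Suc True show ?thesis by auto
  next
    case False
    then have "block (Suc k) = Suc (block k)" and "Suc k = 8 ^ Suc (block k)"
      using Suc by auto
    then show ?thesis by simp
  qed
qed simp

lemma block_eqI:
  assumes "8 ^ s \<le> k" and "k < 8 ^ Suc s"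
  shows "block k = s"
proof -
  have "8 ^ s < (8::nat) ^ Suc (block k)"
    using assms(1) block_bounds[of k] by (meson le_less_trans)
  then have "s \<le> block k"
    by (simp add: power_strict_increasing_iff del: power_Suc)
  moreover have "block k \<le> s"
  proof (cases "block k = 0")
    case False
    with block_bounds[of k] assms(2) have "8 ^ block k < (8::nat) ^ Suc s"
      by (meson le_less_trans)
    then show ?thesis
      by (simp add: power_strict_increasing_iff del: power_Suc)
  qed simp
  ultimately show ?thesis by simp
qed

text \<open>Composing with \<open>Proj 0\<close> preserves the values and increases the size, so
  repetition gives infinitely many programs; their codes are distinct and hence unbounded.\<close>

lemma padding:
  assumes "\<And>n. halts_with A p [n] (f n)"
  shows "\<exists>p'. N \<le> godel_number p' \<and> (\<forall>n. halts_with A p' [n] (f n))"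
proof -
  define pad where "pad i = ((\<lambda>r. Comp (Proj 0) [r]) ^^ i) p" for i
  have "size (pad i) < size (pad (Suc i))" for i
    by (simp add: pad_def)
  then have "inj (\<lambda>i. size (pad i))"
    by (intro strict_mono_imp_inj_on) (simp add: strict_mono_Suc_iff)
  then have "inj (\<lambda>i. godel_number (pad i))"
    by (auto simp: inj_def dest!: godel_number_inject)
  then have "infinite (range (\<lambda>i. godel_number (pad i)))"
    by (simp add: finite_image_iff)
  then obtain i where i: "N \<le> godel_number (pad i)"
    unfolding finite_nat_set_iff_bounded by (auto simp: not_less)
  have "halts_with A (pad i) [n] (f n)" for i n
  proof (induction i)
    case (Suc i)
    have "halts_with A (Proj 0) [f n] (f n)"
      using halts_with.proj[of 0 "[f n]"] by simp
    with Suc show ?case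
      by (auto simp: pad_def intro!: halts_with.comp)
  qed (simp add: pad_def assms)
  with i show ?thesis by blast
qed

subsection \<open>Shifted binary expansions\<close>

text \<open>A first digit 0 keeps the shifted expansion at most 1/2, and digits 1, 1 put it at 3/4
  or more. The open interval leaves only 1, 0, whichever of its two expansions a dyadic
  \<open>x\<close> is given by.\<close>

lemma shifted_digits:
  fixes \<alpha> :: "nat \<Rightarrow> nat"
  assumes digits: "range \<alpha> \<subseteq> {0, 1}" and x: "(\<lambda>n. real (\<alpha> n) / 2 ^ (n + 1)) sums x"
    and J: "frac (2 ^ m * x) \<in> {1/2<..<3/4}"
  shows "\<alpha> m = 1 \<and> \<alpha> (Suc m) = 0"
proof -
  have digit: "\<alpha> n = 0 \<or> \<alpha> n = 1" for n
    using digits by auto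
  \<comment> \<open>The subtracted sum is the integer formed by the first \<open>m\<close> digits,
    so \<open>tail m\<close> has the digits from position \<open>m\<close> on and agrees with
    \<open>2 ^ m * x\<close> modulo 1.\<close>
  define tail where "tail m = 2 ^ m * x - real (\<Sum>i<m. \<alpha> i * 2 ^ (m - Suc i))" for m
  have tail_sums: "(\<lambda>i. real (\<alpha> (i + m)) / 2 ^ (i + 1)) sums tail m" for m
  proof -
    have "(\<lambda>i. 2 ^ m * (real (\<alpha> (i + m)) / 2 ^ (i + m + 1))) sums
        (2 ^ m * (x - (\<Sum>i<m. real (\<alpha> i) / 2 ^ (i + 1))))"
      by (intro sums_mult sums_split_initial_segment x)
    moreover have "2 ^ m * (real (\<alpha> (i + m)) / 2 ^ (i + m + 1)) = real (\<alpha> (i + m)) / 2 ^ (i + 1)"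
      for i by (simp add: power_add)
    moreover have "2 ^ m * (\<Sum>i<m. real (\<alpha> i) / 2 ^ (i + 1)) =
        real (\<Sum>i<m. \<alpha> i * 2 ^ (m - Suc i))"
    proof -
      have "2 ^ m * (real (\<alpha> i) / 2 ^ (i + 1)) = real (\<alpha> i * 2 ^ (m - Suc i))" if "i < m" for i
        using power_add[of "2::real" "i + 1" "m - Suc i"] that by simp
      then show ?thesis
        by (simp add: sum_distrib_left)
    qed
    ultimately show ?thesis
      by (simp add: tail_def right_diff_distrib)
  qed
  have tail_bounds: "0 \<le> tail m \<and> tail m \<le> 1" for m
  proof
    show "0 \<le> tail m"
      by (rule sums_le[OF _ sums_zero tail_sums]) simp
    have "(\<lambda>i. (1/2) ^ Suc i) sums (1::real)"
      by (rule power_half_series)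
    then have half: "(\<lambda>i. 1 / 2 ^ (i + 1)) sums (1::real)"
      by (simp add: power_one_over)
    have "real (\<alpha> (i + m)) / 2 ^ (i + 1) \<le> 1 / 2 ^ (i + 1)" for i
      using digit[of "i + m"] by (intro divide_right_mono) auto
    then show "tail m \<le> 1"
      by (rule sums_le[OF _ tail_sums half])
  qed
  have step: "tail m = (real (\<alpha> m) + tail (Suc m)) / 2" for m
  proof -
    have "(\<lambda>i. real (\<alpha> (Suc i + m)) / 2 ^ (Suc i + 1)) sums (tail m - real (\<alpha> (0 + m)) / 2 ^ (0 + 1))"
      using tail_sums[of m] by (subst sums_Suc_iff) simp
    then have "(\<lambda>i. real (\<alpha> (i + Suc m)) / 2 ^ (i + 1) / 2) sums (tail m - real (\<alpha> m) / 2)"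
      by (simp add: mult.commute)
    from sums_unique2[OF this sums_divide[OF tail_sums[of "Suc m"]]] show ?thesis
      by (simp add: field_simps)
  qed
  have "frac (2 ^ m * x) = frac (tail m + of_int (int (\<Sum>i<m. \<alpha> i * 2 ^ (m - Suc i))))"
    by (simp add: tail_def)
  also have "\<dots> = frac (tail m)"
    by (simp only: frac_add_of_int_right)
  finally have frac: "frac (2 ^ m * x) = frac (tail m)" .
  \<comment> \<open>If all remaining digits were 1, the fractional part would be 0, outside the
    interval.\<close>
  have "tail m \<noteq> 1"
    using J frac by auto
  with tail_bounds[of m] have "frac (tail m) = tail m"
    by (simp add: frac_eq)
  with J frac have tail_J: "1/2 < tail m" "tail m < 3/4"
    by auto
  have "\<alpha> m = 1"
    using digit[of m] tail_J(1) step[of m] tail_bounds[of "Suc m"] by auto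
  moreover have "\<alpha> (Suc m) = 0"
    using digit[of "Suc m"] tail_J(2) step[of m] step[of "Suc m"] tail_bounds[of "Suc (Suc m)"]
      calculation by auto
  ultimately show ?thesis by simp
qed

section \<open>Construction of the shifts and the frequency count\<close>

theorem theorem1:
  "\<exists>q :: nat \<Rightarrow> nat. basic_sequence q \<and> (\<forall>n. \<exists>k. q n = 2 ^ k) \<and> Delta02 q \<and>
    \<not> (\<exists>x :: real. 0 < x \<and> x < 1 \<and> computable_real x \<and> distribution_normal q x)"
proof -
  obtain c where
    c: "\<And>A n f g. recursive_in A n f \<Longrightarrow> recursive_in A n g \<Longrightarrow>
      recursive_in A n (\<lambda>xs. c (f xs) (g xs))"
    and halting: "\<And>p m. c (godel_number p) m \<in> halting_problem \<longleftrightarrow>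
      (\<exists>y>0. halts_with {} p [m] y) \<and> halts_with {} p [Suc m] 0"
    using descent_reduction by blast
  define bad where "bad e m \<longleftrightarrow> c e m \<in> halting_problem" for e m
  define pos where "pos = rec_nat 0 (\<lambda>k m. Suc m + of_bool (bad (block k) (Suc m)))"
  have pos_0: "pos 0 = 0"
    and pos_Suc: "pos (Suc k) = Suc (pos k) + of_bool (bad (block k) (Suc (pos k)))" for k
    by (simp_all add: pos_def)
  define q :: "nat \<Rightarrow> nat" where "q k = 2 ^ (pos (Suc k) - pos k)" for k
  \<comment> \<open>In this form \<open>q k\<close> is computed from \<open>pos k\<close> and
    \<open>block k\<close> with a single query.\<close>
  have q_eq: "q k = 2 + 2 * of_bool (bad (block k) (Suc (pos k)))" for k
    by (simp add: q_def pos_Suc)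
  have prod_q: "(\<Prod>i<k. q i) = 2 ^ pos k" for k
  proof (induction k)
    case (Suc k)
    have "pos k \<le> pos (Suc k)" by (simp add: pos_Suc)
    with Suc show ?case by (simp add: q_def flip: power_add)
  qed (simp add: pos_0)
  have "computable_in halting_problem pos"
    by (rule computable_in_primrec[where h = pos, OF pos_0,
      where g = "\<lambda>k m. Suc m + of_bool (bad (block k) (Suc m))"]) (unfold bad_def,
      auto simp: pos_Suc bad_def
        intro!: recursive_in_intros c recursive_in_apply[OF computable_in_block])
  then have "Delta02 q"
    unfolding Delta02_def computable_in_iff q_eq bad_def
    by (intro recursive_in_intros c recursive_in_apply[OF computable_in_block]
        recursive_in_apply[of _ pos]) (auto simp: computable_in_iff)
  moreover have "\<not> distribution_normal q x" if "computable_real x" for x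
  proof
    assume "distribution_normal q x"
    then have freq: "(\<lambda>n. real (card {k. k < n \<and> frac (2 ^ pos k * x) \<in> {a<..<b}}) / real n)
        \<longlonglongrightarrow> b - a" if "0 \<le> a" "a \<le> b" "b \<le> 1" for a b
      using that unfolding distribution_normal_def uniformly_distributed_mod_1_def prod_q by simp
    define I where "I = {1/2<..<3/4::real}"
    define hits where "hits n = {k. k < n \<and> frac (2 ^ pos k * x) \<in> I}" for n
    have "(\<lambda>n. real (card (hits n)) / real n) \<longlonglongrightarrow> 3/4 - 1/2"
      unfolding hits_def I_def by (rule freq) auto
    \<comment> \<open>3/16 lies midway between the required frequency 1/4 and the 1/8 approached at
      the ends of blocks.\<close>
    then have "\<forall>\<^sub>F n in sequentially. 3/16 < real (card (hits n)) / real n"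
      by (rule order_tendstoD) simp
    then obtain N where N: "\<And>n. N \<le> n \<Longrightarrow> 3/16 < real (card (hits n)) / real n"
      unfolding eventually_sequentially by blast
    obtain \<alpha> where digits: "range \<alpha> \<subseteq> {0, 1}" and \<alpha>: "computable_set {n. \<alpha> n = 1}"
      and x: "(\<lambda>n. real (\<alpha> n) / 2 ^ (n + 1)) sums x"
      using \<open>computable_real x\<close> unfolding computable_real_def by blast
    have "(if n \<in> {n. \<alpha> n = 1} then 1 else 0) = \<alpha> n" for n
      using digits by auto
    with \<alpha> obtain p where "\<And>n. halts_with {} p [n] (\<alpha> n)"
      unfolding computable_set_def computable_in_def by auto
    \<comment> \<open>\<open>Suc N\<close> instead of \<open>N\<close> also ensures
      \<open>e > 0\<close>; for \<open>e = 0\<close> the final estimate would give no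
      contradiction.\<close>
    from padding[of "{}" p \<alpha>, OF this]
    obtain p where large: "Suc N \<le> godel_number p" and p: "\<And>n. halts_with {} p [n] (\<alpha> n)"
      by blast
    define e where "e = godel_number p"
    have bad_iff: "bad e m \<longleftrightarrow> 0 < \<alpha> m \<and> \<alpha> (Suc m) = 0" for m
      unfolding bad_def e_def halting using p halts_with_deterministic by metis
    have no_hit: "frac (2 ^ pos (Suc k) * x) \<notin> I" if "8 ^ e \<le> k" "k < 8 ^ Suc e" for k
    proof
      assume "frac (2 ^ pos (Suc k) * x) \<in> I"
      then have "bad e (pos (Suc k))"
        using shifted_digits[OF digits x, of "pos (Suc k)"] by (simp add: I_def bad_iff)
      moreover have "block k = e"
        using that by (rule block_eqI)
      \<comment> \<open>If the first candidate is bad, its successor carries the digit 0 and so is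
        not bad.\<close>
      ultimately show False
        by (cases "bad e (Suc (pos k))") (auto simp: pos_Suc bad_iff)
    qed
    \<comment> \<open>Since \<open>block k\<close> governs \<open>pos (Suc k)\<close>, the indices
      from \<open>8 ^ e + 1\<close> to \<open>8 ^ Suc e\<close> give no hit.\<close>
    have "hits (Suc (8 ^ Suc e)) \<subseteq> {..8 ^ e}"
    proof
      fix k assume k: "k \<in> hits (Suc (8 ^ Suc e))"
      show "k \<in> {..8 ^ e}"
      proof (cases k)
        case (Suc j)
        with k no_hit[of j] have "\<not> 8 ^ e \<le> j"
          by (auto simp: hits_def simp del: power_Suc)
        with Suc show ?thesis by simp
      qed simp
    qed
    then have "card (hits (Suc (8 ^ Suc e))) \<le> card {..8 ^ e :: nat}"
      by (intro card_mono) auto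
    then have "real (card (hits (Suc (8 ^ Suc e)))) \<le> 8 ^ e + 1"
      by (simp add: of_nat_le_iff[symmetric, where 'a = real] del: of_nat_le_iff)
    moreover have "3/16 < real (card (hits (Suc (8 ^ Suc e)))) / real (Suc (8 ^ Suc e))"
    proof (rule N)
      have "e < 8 ^ e" by (rule power_gt_expt) simp
      then show "N \<le> Suc (8 ^ Suc e)"
        using large by (simp add: e_def)
    qed
    \<comment> \<open>This forces \<open>8 ^ e\<close> below 13/8, whereas it is at least 8.\<close>
    ultimately have "3/16 * (8 * 8 ^ e + 1) < (8 ^ e + 1 :: real)"
      by (subst (asm) pos_less_divide_eq) (simp_all add: add_pos_pos)
    moreover have "(8::real) ^ 1 \<le> 8 ^ e"
      using large by (intro power_increasing) (auto simp: e_def)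
    ultimately show False by simp
  qed
  moreover have "basic_sequence q"
    by (simp add: basic_sequence_def q_eq)
  ultimately show ?thesis
    using q_def by blast
qed

end
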